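(* According to relative worst order analysis, $\mathrm{WR}_{\mathrm{Opt},\mathrm{Nai}}=1$: the constant function $1$ is a bounding function with respect to both $(\mathrm{Opt},\mathrm{Nai},\le)$ and $(\mathrm{Opt},\mathrm{Nai},\ge)$, so Nai and Opt are equivalent under relative worst order analysis.
   Context: Online frequent items problem: an input sequence is $I=a_1,\ldots,a_n$ of items from an infinite universe, $n=|I|$. An algorithm maintains a buffer holding one item; $s_t$ is the buffer content after step $t$; at step $1$ the buffer receives $a_1$, and at each later step $t$ the algorithm either keeps $s_{t-1}$ or replaces it by $a_t$. With $f_I(a)=|\{i:a_i=a\}|/n$, the aggregate frequency of $\mathcal A$ on $I$ is $\mathcal A(I)=\sum_{t=1}^n f_I(s^{\mathcal A}_t)$ (to be maximized). Opt is an optimal offline algorithm (knows all of $I$ in advance, same buffer rules). Nai sets $s_t=a_t$ for all $t$. For an algorithm $\mathcal A$, $\mathcal A_W(I)=\min_\sigma\mathcal A(\sigma(I))$ over all permutations $\sigma(I)$ of $I$. Relative worst order analysis: for a total order $\sqsubseteq\in\{\le,\ge\}$, $f$ is an $(\mathcal A,\mathcal B,\sqsubseteq)$-function if there is $h\in o(f)$ such that for all $I$ (with $n=|I|$), $\mathcal A_W(I)\sqsubseteq (f(n)+h(n))\,\mathcal B_W(I)$. $f$ is a bounding function with respect to $(\mathcal A,\mathcal B,\sqsubseteq)$ if it is an $(\mathcal A,\mathcal B,\sqsubseteq)$-function and for every $(\mathcal A,\mathcal B,\sqsubseteq)$-function $g$, $\lim_{n\to\infty} f(n)/g(n)\sqsubseteq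 1$. Let $f$ be a bounding function w.r.t. $(\mathcal A,\mathcal B,\le)$ and $g$ one w.r.t. $(\mathcal A,\mathcal B,\ge)$. If $\lim f(n)\le1$, then $\mathcal B$ is better than $\mathcal A$ and $g$ is a relative worst order function of $\mathcal A$ and $\mathcal B$; if $\lim g(n)\ge 1$, then $\mathcal A$ is better than $\mathcal B$ and $f$ is a relative worst order function of $\mathcal A$ and $\mathcal B$. Functions $f,g$ are equivalent if $\lim f(n)/g(n)=1$; $\mathrm{WR}_{\mathcal A,\mathcal B}=f(n)$ means $f$ lies in the equivalence class of relative worst order functions of $\mathcal A$ and $\mathcal B$.
   Formalization: The functions f and g are required to be eventually positive (otherwise g = -1 refutes the ≥ claim), and "lim ≤ 1" / "lim ≥ 1" is read as limsup ≤ 1 / liminf ≥ 1, since f/g need not have a limit (e.g. g(n) = 2+(-1)^n). *)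

theory Defs
  imports
    Complex_Main
    "HOL-Library.Multiset"
    "HOL-Library.Landau_Symbols"
    "HOL-Library.Extended_Real"
    "HOL-Library.Infinite_Typeclass"
begin

definition freq :: "'a list \<Rightarrow> 'a \<Rightarrow> real" where
  "freq I a = real (count_list I a) / real (length I)"

text \<open>
  Positions are counted from 0: \<open>s ! t\<close> is the buffer content after item \<open>I ! t\<close> has been read.
\<close>

definition valid_run :: "'a list \<Rightarrow> 'a list \<Rightarrow> bool" where
  "valid_run I s \<longleftrightarrow> length s = length I \<and>
     (\<forall>t < length I. if t = 0 then s ! t = I ! t else s ! t = s ! (t - 1) \<or> s ! t = I ! t)"

definition run_value :: "'a list \<Rightarrow> 'a list \<Rightarrow> real" where
  "run_value I s = (\<Sum>t < length I. freq I (s ! t))"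

text \<open>
  An algorithm is identified with the map from an input sequence to the resulting sequence of
  buffer contents. There is no online restriction, since the optimal algorithm is offline.
\<close>

type_synonym 'a algo = "'a list \<Rightarrow> 'a list"

definition algorithm :: "'a algo \<Rightarrow> bool" where
  "algorithm A \<longleftrightarrow> (\<forall>I. valid_run I (A I))"

definition agg :: "'a algo \<Rightarrow> 'a list \<Rightarrow> real" where
  "agg A I = run_value I (A I)"

definition optimal_offline :: "'a algo \<Rightarrow> bool" where
  "optimal_offline A \<longleftrightarrow> algorithm A \<and> (\<forall>I s. valid_run I s \<longrightarrow> run_value I s \<le> agg A I)"

definition nai :: "'a algo" where
  "nai I = I"

definition worst :: "'a algo \<Rightarrow> 'a list \<Rightarrow> real" where
  "worst A I = Min (agg A ` {J. mset J = mset I})"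

datatype direction = Le | Ge

fun rel :: "direction \<Rightarrow> real \<Rightarrow> real \<Rightarrow> bool" where
  "rel Le x y \<longleftrightarrow> x \<le> y"
| "rel Ge x y \<longleftrightarrow> x \<ge> y"

text \<open>
  The condition that the limit of \<open>q\<close> is at most (at least) \<open>c\<close>. The quotients to which it
  is applied may diverge to infinity or oscillate, so it is read in the extended reals, with limes
  superior for the upper bound and limes inferior for the lower bound: every limit
  point satisfies the bound. See \<open>lim_rel_iff\<close> for the case in which the limit exists.
\<close>

fun lim_rel :: "direction \<Rightarrow> (nat \<Rightarrow> real) \<Rightarrow> real \<Rightarrow> bool" where
  "lim_rel Le q c \<longleftrightarrow> limsup (\<lambda>n. ereal (q n)) \<le> ereal c"
| "lim_rel Ge q c \<longleftrightarrow> liminf (\<lambda>n. ereal (q n)) \<ge> ereal c"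

text \<open>
  As usual for asymptotic bounds, candidate functions are eventually positive; otherwise
  the quotients in \<open>bounding_fun\<close> would not be meaningful. The correction term \<open>h\<close> may have any sign.
\<close>

definition dir_fun :: "direction \<Rightarrow> 'a algo \<Rightarrow> 'a algo \<Rightarrow> (nat \<Rightarrow> real) \<Rightarrow> bool" where
  "dir_fun d A B f \<longleftrightarrow> (\<forall>\<^sub>F n in sequentially. f n > 0) \<and>
     (\<exists>h \<in> o(f). \<forall>I. I \<noteq> [] \<longrightarrow>
        rel d (worst A I) ((f (length I) + h (length I)) * worst B I))"

definition bounding_fun :: "direction \<Rightarrow> 'a algo \<Rightarrow> 'a algo \<Rightarrow> (nat \<Rightarrow> real) \<Rightarrow> bool" where
  "bounding_fun d A B f \<longleftrightarrow> dir_fun d A B f \<and>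
     (\<forall>g. dir_fun d A B g \<longrightarrow> lim_rel d (\<lambda>n. f n / g n) 1)"

text \<open>
  Given a pair \<open>(A, B)\<close>, the next two definitions say that \<open>B\<close> is better than \<open>A\<close> and that \<open>A\<close> is
  better than \<open>B\<close>. Both relations are non-strict, so both can hold for the same pair.
\<close>

definition second_better :: "'a algo \<Rightarrow> 'a algo \<Rightarrow> bool" where
  "second_better A B \<longleftrightarrow>
     (\<exists>f g. bounding_fun Le A B f \<and> bounding_fun Ge A B g \<and> lim_rel Le f 1)"

definition first_better :: "'a algo \<Rightarrow> 'a algo \<Rightarrow> bool" where
  "first_better A B \<longleftrightarrow>
     (\<exists>f g. bounding_fun Le A B f \<and> bounding_fun Ge A B g \<and> lim_rel Ge g 1)"

definition rwo_fun :: "'a algo \<Rightarrow> 'a algo \<Rightarrow> (nat \<Rightarrow> real) \<Rightarrow> bool" where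
  "rwo_fun A B r \<longleftrightarrow>
     (\<exists>f g. bounding_fun Le A B f \<and> bounding_fun Ge A B g \<and>
        (lim_rel Le f 1 \<and> r = g \<or> lim_rel Ge g 1 \<and> r = f))"

definition equiv_fun :: "(nat \<Rightarrow> real) \<Rightarrow> (nat \<Rightarrow> real) \<Rightarrow> bool" where
  "equiv_fun f g \<longleftrightarrow> (\<lambda>n. f n / g n) \<longlonglongrightarrow> 1"

text \<open>
  \<open>WR A B f\<close> stands for \<open>WR\<^sub>A\<^sub>,\<^sub>B = f\<close>. The second conjunct expresses that the relative
  worst order functions belong to one class, so that the equation determines \<open>f\<close> up to equivalence.
\<close>

definition WR :: "'a algo \<Rightarrow> 'a algo \<Rightarrow> (nat \<Rightarrow> real) \<Rightarrow> bool" where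
  "WR A B f \<longleftrightarrow> (\<exists>r. rwo_fun A B r) \<and> (\<forall>r. rwo_fun A B r \<longrightarrow> equiv_fun f r)"

definition rwo_equivalent :: "'a algo \<Rightarrow> 'a algo \<Rightarrow> bool" where
  "rwo_equivalent A B \<longleftrightarrow> first_better A B \<and> second_better A B"

lemma lim_rel_iff:
  assumes "(\<lambda>n. ereal (q n)) \<longlonglongrightarrow> L"
  shows "lim_rel Le q c \<longleftrightarrow> L \<le> ereal c" and "lim_rel Ge q c \<longleftrightarrow> L \<ge> ereal c"
  using lim_imp_Limsup[OF _ assms] lim_imp_Liminf[OF _ assms] by simp_all

lemma algorithm_nai: "algorithm nai"
  by (simp add: algorithm_def valid_run_def nai_def)

lemma finite_valid_runs: "finite {s. valid_run I s}"
proof (rule finite_subset)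
  have "set s \<subseteq> set I" if s: "valid_run I s" for s
  proof -
    have "t < length I \<Longrightarrow> s ! t \<in> set I" for t
    proof (induction t)
      case 0
      then show ?case using s by (auto simp: valid_run_def)
    next
      case (Suc t)
      then show ?case using s by (fastforce simp: valid_run_def)
    qed
    moreover have "length s = length I" using s by (simp add: valid_run_def)
    ultimately show ?thesis by (auto simp: in_set_conv_nth)
  qed
  then show "{s. valid_run I s} \<subseteq> {s. set s \<subseteq> set I \<and> length s = length I}"
    using valid_run_def by blast
  show "finite {s. set s \<subseteq> set I \<and> length s = length I}"
    by (rule finite_lists_length_eq) simp
qed

lemma optimal_offline_exists: "\<exists>A :: 'a algo. optimal_offline A"
proof -
  have "\<exists>s. valid_run I s \<and> (\<forall>s'. valid_run I s' \<longrightarrow> run_value I s' \<le> run_value I s)"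
    for I :: "'a list"
  proof -
    let ?V = "run_value I ` {s. valid_run I s}"
    have fin: "finite ?V" using finite_valid_runs by blast
    have "valid_run I (nai I)" using algorithm_nai by (auto simp: algorithm_def)
    then have "?V \<noteq> {}" by blast
    with fin have "Max ?V \<in> ?V" by (rule Max_in)
    then obtain s where "valid_run I s" "run_value I s = Max ?V" by auto
    with fin show ?thesis by (metis Max_ge imageI mem_Collect_eq)
  qed
  then show ?thesis
    unfolding optimal_offline_def algorithm_def agg_def by metis
qed

lemma worst_attained: "\<exists>J. mset J = mset I \<and> worst A I = agg A J"
proof -
  have "worst A I \<in> agg A ` {J. mset J = mset I}"
    unfolding worst_def by (rule Min_in) (auto simp: mset_eq_finite)
  then show ?thesis by auto
qed

end

theory Submission
  imports Defs
begin

text \<open>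
  Nai is itself a valid run, and its value depends only on the multiset of the input. If the items
  arrive in order of increasing frequency, then no item seen so far is more frequent than the
  current one, so no run can do better than Nai on this ordering. Hence the worst-order values of
  Opt and Nai coincide exactly, and the asymptotic claims follow.
\<close>

lemma agg_nai: "agg nai I = (\<Sum>x\<leftarrow>I. freq I x)"
  by (simp add: agg_def run_value_def nai_def sum_list_sum_nth atLeast0LessThan)

lemma freq_mset_cong: "mset I = mset J \<Longrightarrow> freq I = freq J"
  unfolding freq_def by (metis count_mset mset_eq_length)

lemma agg_nai_mset_cong:
  assumes "mset I = mset J"
  shows "agg nai I = agg nai J"
proof -
  have "agg nai I = sum_mset (image_mset (freq I) (mset I))"
    by (simp add: agg_nai flip: sum_mset_sum_list)
  also have "\<dots> = sum_mset (image_mset (freq J) (mset J))"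
    using assms freq_mset_cong by metis
  also have "\<dots> = agg nai J"
    by (simp add: agg_nai flip: sum_mset_sum_list)
  finally show ?thesis .
qed

text \<open>Positivity allows the worst-order value to be cancelled from the defining inequality of
  a candidate function.\<close>

lemma agg_nai_pos:
  assumes "I \<noteq> []"
  shows "agg nai I > 0"
proof -
  have "freq I (I ! t) > 0" if "t < length I" for t
    using that by (auto simp: freq_def count_list_0_iff intro!: divide_pos_pos gr0I)
  then show ?thesis
    unfolding agg_def run_value_def nai_def using assms by (intro sum_pos) auto
qed

lemma worst_le: "mset J = mset I \<Longrightarrow> worst A I \<le> agg A J"
  unfolding worst_def by (rule Min_le) (auto simp: mset_eq_finite)

lemma worst_nai: "worst nai I = agg nai I"
  using worst_attained agg_nai_mset_cong by metis

text \<open>Induction on the step: a kept item is bounded by the previous input item, which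
  sortedness places below the current one; a replaced item is the current one.\<close>

lemma freq_valid_run_le:
  assumes "valid_run J s" and "sorted (map (freq J) J)" and "t < length J"
  shows "freq J (s ! t) \<le> freq J (J ! t)"
  using assms(3)
proof (induction t)
  case 0
  then show ?case using assms(1) by (auto simp: valid_run_def)
next
  case (Suc t)
  then have "freq J (J ! t) \<le> freq J (J ! Suc t)"
    using sorted_nth_mono[OF assms(2), of t "Suc t"] by simp
  moreover have "s ! Suc t = s ! t \<or> s ! Suc t = J ! Suc t"
    using assms(1) Suc.prems by (auto simp: valid_run_def)
  ultimately show ?case using Suc by auto
qed

lemma worst_opt_eq_nai:
  assumes "optimal_offline Opt"
  shows "worst Opt I = worst nai I"
proof (rule antisym)
  \<comment> \<open>Permuting leaves frequencies unchanged, so sorting by \<open>freq I\<close> also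
    sorts \<open>?J\<close> by its own frequencies.\<close>
  let ?J = "sort_key (freq I) I"
  have J: "mset ?J = mset I" by simp
  have run: "valid_run ?J (Opt ?J)"
    using assms by (simp add: optimal_offline_def algorithm_def)
  have sorted: "sorted (map (freq ?J) ?J)"
    using freq_mset_cong[OF J] by simp
  have "worst Opt I \<le> agg Opt ?J" by (rule worst_le[OF J])
  also have "\<dots> \<le> agg nai ?J"
    unfolding agg_def run_value_def nai_def
    by (intro sum_mono freq_valid_run_le[OF run sorted]) simp
  also have "\<dots> = worst nai I" using agg_nai_mset_cong[OF J] by (simp add: worst_nai)
  finally show "worst Opt I \<le> worst nai I" .
next
  \<comment> \<open>On a worst ordering \<open>K\<close> for \<open>Opt\<close>, Nai is one of the
    runs that \<open>Opt\<close> must match.\<close>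
  obtain K where K: "mset K = mset I" "worst Opt I = agg Opt K"
    using worst_attained by blast
  have "agg nai K = run_value K (nai K)" by (simp add: agg_def)
  also have "\<dots> \<le> agg Opt K"
    using assms algorithm_nai by (auto simp: optimal_offline_def algorithm_def)
  finally show "worst nai I \<le> worst Opt I"
    using K agg_nai_mset_cong by (metis worst_nai)
qed

text \<open>Real thresholds suffice because \<open>q\<close> is real-valued; this keeps later
  arguments free of extended reals.\<close>

lemma lim_rel_Le_iff: "lim_rel Le q c \<longleftrightarrow> (\<forall>y>c. \<forall>\<^sub>F n in sequentially. q n < y)"
proof
  assume "lim_rel Le q c"
  then show "\<forall>y>c. \<forall>\<^sub>F n in sequentially. q n < y"
    by (auto simp: Limsup_le_iff dest: spec[of _ "ereal _"])
next
  assume q: "\<forall>y>c. \<forall>\<^sub>F n in sequentially. q n < y"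
  have "\<forall>\<^sub>F n in sequentially. ereal (q n) < y" if "ereal c < y" for y
    \<comment> \<open>An infinite \<open>y\<close> is trivial: plus infinity exceeds every real, and
      minus infinity is excluded by the assumption on \<open>y\<close>.\<close>
    using that q by (cases y) auto
  then show "lim_rel Le q c" by (simp add: Limsup_le_iff)
qed

lemma lim_rel_Ge_iff: "lim_rel Ge q c \<longleftrightarrow> (\<forall>y<c. \<forall>\<^sub>F n in sequentially. y < q n)"
proof
  assume "lim_rel Ge q c"
  then show "\<forall>y<c. \<forall>\<^sub>F n in sequentially. y < q n"
    by (auto simp: le_Liminf_iff dest: spec[of _ "ereal _"])
next
  assume q: "\<forall>y<c. \<forall>\<^sub>F n in sequentially. y < q n"
  have "\<forall>\<^sub>F n in sequentially. y < ereal (q n)" if "y < ereal c" for y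
    using that q by (cases y) auto
  then show "lim_rel Ge q c" by (simp add: le_Liminf_iff)
qed

text \<open>Any threshold beyond \<open>c\<close> is eventually respected by \<open>p\<close>, hence
  by \<open>q\<close>, which may itself oscillate.\<close>

lemma lim_rel_of_tendsto:
  assumes "p \<longlonglongrightarrow> c" and "\<forall>\<^sub>F n in sequentially. rel d (q n) (p n)"
  shows "lim_rel d q c"
proof (cases d)
  case Le
  have "\<forall>\<^sub>F n in sequentially. q n < y" if "c < y" for y
    using order_tendstoD(2)[OF assms(1) that] assms(2) by eventually_elim (simp add: Le)
  then show ?thesis unfolding Le lim_rel_Le_iff by blast
next
  case Ge
  have "\<forall>\<^sub>F n in sequentially. y < q n" if "y < c" for y
    using order_tendstoD(1)[OF assms(1) that] assms(2) by eventually_elim (simp add: Ge)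
  then show ?thesis unfolding Ge lim_rel_Ge_iff by blast
qed

text \<open>One side of the limit is \<open>inv\<close> itself; the other comes from
  \<open>r\<close> by taking reciprocals, which reverses the inequality for positive values.\<close>

lemma tendsto_inverse_of_lim_rel:
  fixes r :: "nat \<Rightarrow> real"
  assumes pos: "\<forall>\<^sub>F n in sequentially. r n > 0"
    and r: "lim_rel d r 1" and inv: "lim_rel d (\<lambda>n. 1 / r n) 1"
  shows "(\<lambda>n. 1 / r n) \<longlonglongrightarrow> 1"
proof (rule order_tendstoI)
  fix a :: real
  assume a: "a < 1"
  show "\<forall>\<^sub>F n in sequentially. a < 1 / r n"
  proof (cases d)
    case Ge
    show ?thesis using inv a unfolding Ge lim_rel_Ge_iff by blast
  next
    case Le
    show ?thesis
    proof (cases "a \<le> 0")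
      \<comment> \<open>Here \<open>1 / a\<close> is not a threshold above 1, but positivity of
        \<open>r\<close> already suffices.\<close>
      case True
      from pos show ?thesis
        by (rule eventually_mono) (rule order.strict_trans1[OF True], simp)
    next
      case False
      then have "1 / a > 1" using a by simp
      then have "\<forall>\<^sub>F n in sequentially. r n < 1 / a"
        using r unfolding Le lim_rel_Le_iff by blast
      with pos show ?thesis
        by eventually_elim (use False in \<open>simp add: field_simps\<close>)
    qed
  qed
next
  fix a :: real
  assume a: "1 < a"
  show "\<forall>\<^sub>F n in sequentially. 1 / r n < a"
  proof (cases d)
    case Le
    show ?thesis using inv a unfolding Le lim_rel_Le_iff by blast
  next
    case Ge
    have "1 / a < 1" using a by simp
    then have "\<forall>\<^sub>F n in sequentially. 1 / a < r n"
      using r unfolding Ge lim_rel_Ge_iff by blast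
    with pos show ?thesis
      by eventually_elim (use a in \<open>simp add: field_simps\<close>)
  qed
qed

text \<open>For a candidate \<open>g\<close> with correction \<open>h\<close>, cancelling the common
  worst-order value compares 1 with \<open>g n + h n\<close>; dividing by \<open>g n\<close> then
  compares \<open>1 / g n\<close> with a sequence tending to 1.\<close>

lemma bounding_fun_one:
  fixes A B :: "'a algo"
  assumes eq: "\<And>I. worst A I = worst B I" and pos: "\<And>I. I \<noteq> [] \<Longrightarrow> worst B I > 0"
  shows "bounding_fun d A B (\<lambda>_. 1)"
proof -
  have "dir_fun d A B (\<lambda>_. 1)"
    unfolding dir_fun_def by (cases d) (auto simp: eq intro!: bexI[of _ "\<lambda>_. 0"])
  moreover have "lim_rel d (\<lambda>n. 1 / g n) 1" if g: "dir_fun d A B g" for g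
  proof -
    have gpos: "\<forall>\<^sub>F n in sequentially. g n > 0"
      using g by (simp add: dir_fun_def)
    obtain h where h: "h \<in> o(g)" and bound: "\<forall>I. I \<noteq> [] \<longrightarrow>
        rel d (worst A I) ((g (length I) + h (length I)) * worst B I)"
      using g unfolding dir_fun_def by blast
    have one: "rel d 1 (g n + h n)" if "n > 0" for n
    proof -
      \<comment> \<open>Any input of length \<open>n\<close> serves, since its worst-order value
        cancels.\<close>
      define I where "I = replicate n (undefined :: 'a)"
      have I: "I \<noteq> []" "length I = n" using that by (auto simp: I_def)
      show ?thesis using bound[rule_format, OF I(1)] pos[OF I(1)] by (cases d) (auto simp: eq I(2))
    qed
    have "(\<lambda>n. h n / g n) \<longlonglongrightarrow> 0"
      using smalloD_tendsto[OF h] .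
    then have "(\<lambda>n. 1 + h n / g n) \<longlonglongrightarrow> 1 + 0"
      by (intro tendsto_intros)
    moreover have "\<forall>\<^sub>F n in sequentially. rel d (1 / g n) (1 + h n / g n)"
      using gpos eventually_gt_at_top[of 0]
    proof eventually_elim
      case (elim n)
      then have "1 + h n / g n = (g n + h n) / g n" by (simp add: add_divide_distrib)
      with elim one[of n] show ?case by (cases d) (auto intro: divide_right_mono)
    qed
    ultimately show ?thesis by (auto intro: lim_rel_of_tendsto)
  qed
  ultimately show ?thesis by (simp add: bounding_fun_def)
qed

text \<open>Each of the two functions is a candidate against which the other is tested, so both
  quotients are bounded in the same direction.\<close>

lemma equiv_fun_one_bounding_fun:
  assumes "bounding_fun d A B (\<lambda>_. 1)" and "bounding_fun d A B r"
  shows "equiv_fun (\<lambda>_. 1) r"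
proof -
  have "lim_rel d (\<lambda>n. r n / 1) 1" "lim_rel d (\<lambda>n. 1 / r n) 1"
    using assms unfolding bounding_fun_def by blast+
  moreover have "\<forall>\<^sub>F n in sequentially. r n > 0"
    using assms(2) by (simp add: bounding_fun_def dir_fun_def)
  ultimately show ?thesis
    unfolding equiv_fun_def by (intro tendsto_inverse_of_lim_rel) simp_all
qed

theorem theorem8:
  fixes Opt :: "('a::infinite) algo"
  assumes "optimal_offline Opt"
  shows "bounding_fun Le Opt nai (\<lambda>_. 1) \<and> bounding_fun Ge Opt nai (\<lambda>_. 1) \<and>
         WR Opt nai (\<lambda>_. 1) \<and> rwo_equivalent Opt nai"
proof -
  have one: "bounding_fun d Opt nai (\<lambda>_. 1)" for d
    using worst_opt_eq_nai[OF assms] by (rule bounding_fun_one) (simp add: worst_nai agg_nai_pos)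
  have lim: "lim_rel d (\<lambda>_. 1) 1" for d
    by (rule lim_rel_of_tendsto[of "\<lambda>_. 1"]) (cases d; simp)+
  have "WR Opt nai (\<lambda>_. 1)"
    \<comment> \<open>Whichever case of \<open>rwo_fun\<close> applies, the function is a bounding
      function in one of the directions, hence equivalent to 1.\<close>
    unfolding WR_def rwo_fun_def using one lim equiv_fun_one_bounding_fun by metis
  moreover have "rwo_equivalent Opt nai"
    unfolding rwo_equivalent_def first_better_def second_better_def using one lim by blast
  ultimately show ?thesis using one by blast
qed

end
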